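(* Let $m\ge 2$ be an integer and let $f:[-1,1]^2\to\mathbb{R}$ be a continuous function such that the kernel $((x,z),(y,w))\in(S^1\times S^m)^2\mapsto f(x\cdot y,z\cdot w)$ is positive definite. Let $J_f=\{(k,l)\in\mathbb{Z}_+^2 : a_{k,l}^{1,m}>0\}$, where $a_{k,l}^{1,m}$ are the coefficients of $f$ in its series representation (see context). If $$\big\{l : \{k : (k,l)\in J_f\}\in \mathrm{SPD}(S^1)\big\}\in\mathrm{SPD}(S^m),$$ then the kernel $((x,z),(y,w))\in(S^1\times S^m)^2\mapsto f(x\cdot y,z\cdot w)$ is strictly positive definite on $S^1\times S^m$.
   Context: $S^d$ is the unit sphere of $\mathbb{R}^{d+1}$, $\cdot$ is the usual inner product and $\mathbb{Z}_+=\{0,1,2,\ldots\}$. A kernel $K:X\times X\to\mathbb{R}$ on a nonempty set $X$ is positive definite if $K(u,v)=K(v,u)$ for all $u,v$ and $\sum_{\mu,\nu=1}^n c_\mu c_\nu K(u_\mu,u_\nu)\ge0$ for all $n\ge1$, all distinct $u_1,\ldots,u_n\in X$ and all real $c_1,\ldots,c_n$; it is strictly positive definite if moreover these inequalities are strict whenever at least one $c_\mu$ is nonzero. Polynomials: $P_0^1\equiv1$ and $P_k^1(\cos\theta)=\frac{2}{k}\cos k\theta$ for $k\ge1$; for $d\ge2$, $P_l^d$ is the Gegenbauer polynomial of degree $l$ attached to the number $(d-1)/2$, normalized by $P_l^d(1)=\binom{l+d-2}{l}$. Series representations (known facts): (a) a continuous $g:[-1,1]\to\mathbb{R}$ gives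 a positive definite kernel $(z,w)\mapsto g(z\cdot w)$ on $S^d$ ($d\ge1$) if and only if $g(t)=\sum_{l=0}^\infty a_l^dP_l^d(t)$ with $a_l^d\ge0$ and $\sum_l a_l^dP_l^d(1)<\infty$. (b) A continuous $f:[-1,1]^2\to\mathbb{R}$ gives a positive definite kernel $((x,z),(y,w))\mapsto f(x\cdot y,z\cdot w)$ on $S^1\times S^m$ if and only if $f(t,s)=\sum_{k,l=0}^\infty a_{k,l}^{1,m}P_k^1(t)P_l^m(s)$, with $a_{k,l}^{1,m}\ge0$ and $\sum_{k,l}a_{k,l}^{1,m}P_k^1(1)P_l^m(1)<\infty$. In both cases the coefficients are determined by the function. For $I\subset\mathbb{Z}_+$ and $d\ge1$, write $I\in\mathrm{SPD}(S^d)$ if there exists a continuous $g:[-1,1]\to\mathbb{R}$ such that $(z,w)\in(S^d)^2\mapsto g(z\cdot w)$ is strictly positive definite and the set $\{l : a_l^d>0\}$ attached to $g$ by (a) is precisely $I$. (Strict positive definiteness of such a kernel depends only on the set $\{l : a_l^d>0\}$, not on the actual values of the coefficients.) *)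

theory Defs
  imports "HOL-Analysis.Analysis"
begin

definition pos_def_kernel :: "'a set \<Rightarrow> ('a \<Rightarrow> 'a \<Rightarrow> real) \<Rightarrow> bool" where
  "pos_def_kernel X K \<longleftrightarrow>
     (\<forall>u\<in>X. \<forall>v\<in>X. K u v = K v u) \<and>
     (\<forall>n\<ge>1. \<forall>(u :: nat \<Rightarrow> 'a) (c :: nat \<Rightarrow> real).
        inj_on u {1..n} \<and> u ` {1..n} \<subseteq> X \<longrightarrow>
        (\<Sum>\<mu>=1..n. \<Sum>\<nu>=1..n. c \<mu> * c \<nu> * K (u \<mu>) (u \<nu>)) \<ge> 0)"

definition strictly_pos_def_kernel :: "'a set \<Rightarrow> ('a \<Rightarrow> 'a \<Rightarrow> real) \<Rightarrow> bool" where
  "strictly_pos_def_kernel X K \<longleftrightarrow>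
     pos_def_kernel X K \<and>
     (\<forall>n\<ge>1. \<forall>(u :: nat \<Rightarrow> 'a) (c :: nat \<Rightarrow> real).
        inj_on u {1..n} \<and> u ` {1..n} \<subseteq> X \<and> (\<exists>\<mu>\<in>{1..n}. c \<mu> \<noteq> 0) \<longrightarrow>
        (\<Sum>\<mu>=1..n. \<Sum>\<nu>=1..n. c \<mu> * c \<nu> * K (u \<mu>) (u \<nu>)) > 0)"

text \<open>
  The Gegenbauer polynomial of degree \<open>l\<close> attached to \<open>\<alpha>\<close>, defined by its generating function
  \<open>(1 - 2 t r + r\<^sup>2) powr (- \<alpha>) = (\<Sum>l. gegenbauer \<alpha> l t * r ^ l)\<close>: the formal power series
  \<open>(1 + X) powr (- \<alpha>)\<close> is composed with \<open>X\<^sup>2 - 2 t X\<close>.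
\<close>
definition gegenbauer :: "real \<Rightarrow> nat \<Rightarrow> real \<Rightarrow> real" where
  "gegenbauer \<alpha> l t = fps_nth (fps_binomial (- \<alpha>) oo (fps_X ^ 2 - fps_const (2 * t) * fps_X)) l"

text \<open>
  The polynomial \<open>P\<^sub>l\<^sup>d\<close> for \<open>d \<ge> 1\<close>. For \<open>d = 1\<close> it is given by its values at \<open>t = cos \<theta>\<close>, so it is
  only meaningful for \<open>t\<close> in \<open>[-1, 1]\<close>.
\<close>
definition sphere_poly :: "nat \<Rightarrow> nat \<Rightarrow> real \<Rightarrow> real" where
  "sphere_poly d l t =
     (if d = 1 then (if l = 0 then 1 else 2 / real l * cos (real l * arccos t))
      else gegenbauer ((real d - 1) / 2) l t)"

lemma sphere_poly_1_cos:
  assumes "k \<ge> 1"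
  shows "sphere_poly 1 k (cos \<theta>) = 2 / real k * cos (real k * \<theta>)"
proof -
  define \<phi> where "\<phi> = arccos (cos \<theta>)"
  have "cos \<phi> = cos \<theta>"
    unfolding \<phi>_def by simp
  then obtain n :: real where n: "n \<in> \<int>" "\<phi> = \<theta> + 2 * n * pi \<or> \<phi> = - \<theta> + 2 * n * pi"
    unfolding cos_eq by auto
  have "cos (real k * \<phi>) = cos (real k * \<theta>)"
    unfolding cos_eq
  proof (rule bexI[of _ "real k * n"])
    show "real k * \<phi> = real k * \<theta> + 2 * (real k * n) * pi \<or>
          real k * \<phi> = - (real k * \<theta>) + 2 * (real k * n) * pi"
      using n(2)
    proof
      assume "\<phi> = - \<theta> + 2 * n * pi"
      then have "real k * \<phi> = real k * (- \<theta> + 2 * n * pi)" by (rule arg_cong)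
      then show ?thesis by (simp add: algebra_simps)
    qed (simp add: algebra_simps)
  qed (use n(1) in auto)
  then show ?thesis
    using assms by (simp add: sphere_poly_def \<phi>_def)
qed

text \<open>The stated normalization at \<open>t = 1\<close>.\<close>
lemma sphere_poly_at_1:
  assumes "d \<ge> 2"
  shows "sphere_poly d l 1 = real ((l + d - 2) choose l)"
proof -
  define \<alpha> where "\<alpha> = (real d - 1) / 2"
  define A :: "real fps" where "A = fps_X ^ 2 - fps_const 2 * fps_X"
  define B where "B = fps_binomial (- \<alpha>)"
  define G where "G = B oo A"
  have A0: "fps_nth A 0 = 0"
    by (simp add: A_def)
  have ode: "(1 + fps_X) * fps_deriv B = fps_const (- \<alpha>) * B"
    unfolding B_def fps_binomial_deriv
    by (simp add: fps_divide_unit mult.commute mult.left_commute inverse_mult_eq_1')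
  have A1: "1 + A = (1 - fps_X) * (1 - fps_X)"
    by (simp add: A_def power2_eq_square algebra_simps numeral_fps_const[symmetric])
  have dA: "fps_deriv A = fps_const (- 2) * (1 - fps_X)"
    by (simp add: A_def power2_eq_square algebra_simps numeral_fps_const[symmetric])
  have "((1 + fps_X) * fps_deriv B) oo A = (fps_const (- \<alpha>) * B) oo A"
    by (simp only: ode)
  then have "(1 + A) * (fps_deriv B oo A) = fps_const (- \<alpha>) * G"
    by (simp add: fps_compose_mult_distrib[OF A0] fps_compose_add_distrib A0 G_def)
  then have "(1 + A) * fps_deriv G = fps_const (- \<alpha>) * G * fps_deriv A"
    unfolding G_def fps_compose_deriv[OF A0] by (simp add: mult.assoc[symmetric])
  then have "(1 - fps_X) * ((1 - fps_X) * fps_deriv G) =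
             (1 - fps_X) * (fps_const (- 2) * fps_const (- \<alpha>) * G)"
    unfolding A1 dA by (simp only: ac_simps)
  moreover have "fps_nth (1 - fps_X :: real fps) 0 \<noteq> 0"
    by simp
  then have "(1 - fps_X :: real fps) \<noteq> 0"
    by (metis fps_zero_nth)
  ultimately have eq: "(1 - fps_X) * fps_deriv G = fps_const (2 * \<alpha>) * G"
    by simp
  have rec: "real (Suc n) * fps_nth G (Suc n) = (real n + 2 * \<alpha>) * fps_nth G n" for n
  proof -
    have "fps_nth ((1 - fps_X) * fps_deriv G) n = 2 * \<alpha> * fps_nth G n"
      by (simp add: eq)
    then show ?thesis
      by (cases n) (simp_all add: left_diff_distrib algebra_simps)
  qed
  have "fps_nth G n = real ((n + d - 2) choose n)" for n
  proof (induction n)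
    case 0
    then show ?case by (simp add: G_def B_def)
  next
    case (Suc n)
    obtain e where e: "d = e + 2"
      using assms by (metis add.commute le_Suc_ex)
    have "real (Suc n) * fps_nth G (Suc n) = real (n + e + 1) * real ((n + e) choose n)"
      using rec[of n] Suc by (simp add: e \<alpha>_def algebra_simps)
    also have "\<dots> = real (Suc (n + e) * ((n + e) choose n))"
      by (simp add: algebra_simps)
    also have "\<dots> = real (Suc n) * real (Suc (n + e) choose Suc n)"
      using Suc_times_binomial_eq[of "n + e" n] by (metis of_nat_mult mult.commute)
    finally show ?case by (simp add: e)
  qed
  then show ?thesis
    using assms by (simp add: sphere_poly_def gegenbauer_def G_def B_def A_def \<alpha>_def)
qed

text \<open>
  \<open>a\<close> is the coefficient family in the series representation of a positive definite function on
  \<open>S\<^sup>d\<close>, respectively on \<open>S\<^sup>1 \<times> S\<^sup>m\<close>; the double series is summed unconditionally.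
\<close>
definition sphere_expansion :: "nat \<Rightarrow> (real \<Rightarrow> real) \<Rightarrow> (nat \<Rightarrow> real) \<Rightarrow> bool" where
  "sphere_expansion d g a \<longleftrightarrow>
     (\<forall>l. a l \<ge> 0) \<and> summable (\<lambda>l. a l * sphere_poly d l 1) \<and>
     (\<forall>t\<in>{-1..1}. (\<lambda>l. a l * sphere_poly d l t) sums g t)"

definition circle_sphere_expansion ::
  "nat \<Rightarrow> (real \<Rightarrow> real \<Rightarrow> real) \<Rightarrow> (nat \<Rightarrow> nat \<Rightarrow> real) \<Rightarrow> bool" where
  "circle_sphere_expansion m f a \<longleftrightarrow>
     (\<forall>k l. a k l \<ge> 0) \<and>
     (\<lambda>(k, l). a k l * sphere_poly 1 k 1 * sphere_poly m l 1) summable_on UNIV \<and>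
     (\<forall>t\<in>{-1..1}. \<forall>s\<in>{-1..1}.
        ((\<lambda>(k, l). a k l * sphere_poly 1 k t * sphere_poly m l s) has_sum f t s) UNIV)"

text \<open>
  The set \<open>J\<^sub>f\<close> of indices with positive coefficient. The existential quantifier merely names the
  coefficients of \<open>f\<close>, which exist and are unique when the kernel of \<open>f\<close> is positive definite.
\<close>
definition coeff_support :: "nat \<Rightarrow> (real \<Rightarrow> real \<Rightarrow> real) \<Rightarrow> (nat \<times> nat) set" where
  "coeff_support m f = {(k, l). \<exists>a. circle_sphere_expansion m f a \<and> a k l > 0}"

text \<open>The family \<open>SPD(S\<^sup>d)\<close>, where \<open>S\<^sup>d\<close> is the unit sphere of \<open>real ^ 'n\<close>, so \<open>d = CARD('n) - 1\<close>.\<close>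
definition SPD :: "'n::finite itself \<Rightarrow> nat set set" where
  "SPD _ = {I. \<exists>g a. continuous_on {-1..1} g \<and>
     strictly_pos_def_kernel (sphere (0 :: real ^ 'n) 1) (\<lambda>z w. g (z \<bullet> w)) \<and>
     sphere_expansion (CARD('n) - 1) g a \<and> {l. a l > 0} = I}"

end

theory Submission
  imports Defs
begin

text \<open>
  A vanishing quadratic form of \<open>f\<close> forces every term of its double series to vanish, since each
  \<open>P\<^sub>k\<^sup>1(x \<cdot> y) P\<^sub>l\<^sup>m(z \<cdot> w)\<close> is positive definite. Writing \<open>P\<^sub>l\<^sup>m(z \<cdot> w) = \<Sum>\<^sub>i Y\<^sub>i(z) Y\<^sub>i(w)\<close>, strict
  positive definiteness on the circle kills the functions \<open>\<Sum>\<^sub>z c(x, z) Y\<^sub>i(z)\<close> of \<open>x\<close> for every \<open>l\<close> in the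
  outer index set; for each fixed \<open>x\<close> this makes the \<open>P\<^sub>l\<^sup>m\<close>-form of \<open>c(x, _)\<close> vanish, and strict
  positive definiteness on \<open>S\<^sup>m\<close> gives \<open>c = 0\<close>.

  The functions \<open>Y\<^sub>i\<close> come from expanding \<open>(x \<cdot> y) ^ l\<close> into products of monomials and applying,
  in both variables, the operator \<open>\<Sum>\<^sub>j c\<^sub>j |y|\<^bsup>2j\<^esup> \<Delta>\<^bsup>j\<^esup>\<close> that projects homogeneous polynomials of degree
  \<open>l\<close> onto the harmonic ones, up to a positive factor: it sends \<open>(x \<cdot> y) ^ l\<close> to the homogenized
  Gegenbauer polynomial, which is harmonic.
\<close>

section \<open>Directional derivatives and the Laplacian on polynomial functions\<close>

definition dir_deriv :: "'a::real_normed_vector \<Rightarrow> ('a \<Rightarrow> real) \<Rightarrow> 'a \<Rightarrow> real" where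
  "dir_deriv v p x = deriv (\<lambda>t. p (x + t *\<^sub>R v)) 0"

lemma dir_deriv_eqI:
  "((\<lambda>t. p (x + t *\<^sub>R v)) has_real_derivative D) (at 0) \<Longrightarrow> dir_deriv v p x = D"
  unfolding dir_deriv_def by (rule DERIV_imp_deriv)

text \<open>Structural induction builds a polynomial derivative from the sum and product rules, and
  uniqueness of derivatives identifies it with \<open>dir_deriv v p\<close>. Staying among
  polynomials is what allows derivatives to be iterated.\<close>

lemma real_polynomial_function_dir_deriv:
  assumes "real_polynomial_function p"
  shows "real_polynomial_function (dir_deriv v p)"
    and "((\<lambda>t. p (x + t *\<^sub>R v)) has_real_derivative dir_deriv v p x) (at 0)"
proof -
  have "\<exists>q. real_polynomial_function q \<and>
          (\<forall>x. ((\<lambda>t. p (x + t *\<^sub>R v)) has_real_derivative q x) (at 0))"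
    using assms
  proof induction
    case (linear f)
    interpret bounded_linear f by fact
    have "((\<lambda>t. f x + t * f v) has_real_derivative f v) (at 0)" for x
      by (auto intro!: derivative_eq_intros)
    then show ?case
      by (intro exI[of _ "\<lambda>_. f v"]) (auto simp: add scaleR)
  next
    case (const c)
    then show ?case
      by (intro exI[of _ "\<lambda>_. 0"]) auto
  next
    case (add f g)
    then obtain f' g' where
      "real_polynomial_function f'" "real_polynomial_function g'"
      "\<And>x. ((\<lambda>t. f (x + t *\<^sub>R v)) has_real_derivative f' x) (at 0)"
      "\<And>x. ((\<lambda>t. g (x + t *\<^sub>R v)) has_real_derivative g' x) (at 0)"
      by blast
    then show ?case
      by (intro exI[of _ "\<lambda>x. f' x + g' x"]) (auto intro!: derivative_eq_intros)
  next
    case (mult f g)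
    then obtain f' g' where
      "real_polynomial_function f'" "real_polynomial_function g'"
      "\<And>x. ((\<lambda>t. f (x + t *\<^sub>R v)) has_real_derivative f' x) (at 0)"
      "\<And>x. ((\<lambda>t. g (x + t *\<^sub>R v)) has_real_derivative g' x) (at 0)"
      by blast
    then show ?case
      using mult.hyps
      by (intro exI[of _ "\<lambda>x. f' x * g x + f x * g' x"])
         (auto intro!: derivative_eq_intros)
  qed
  then obtain q where q: "real_polynomial_function q"
    "\<And>x. ((\<lambda>t. p (x + t *\<^sub>R v)) has_real_derivative q x) (at 0)"
    by blast
  then have "dir_deriv v p = q"
    by (intro ext dir_deriv_eqI)
  with q show "real_polynomial_function (dir_deriv v p)"
    and "((\<lambda>t. p (x + t *\<^sub>R v)) has_real_derivative dir_deriv v p x) (at 0)"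
    by simp_all
qed

lemma dir_deriv_sum:
  assumes "\<And>i. i \<in> I \<Longrightarrow> real_polynomial_function (p i)"
  shows "dir_deriv v (\<lambda>x. \<Sum>i\<in>I. c i * p i x) = (\<lambda>x. \<Sum>i\<in>I. c i * dir_deriv v (p i) x)"
  by (intro ext dir_deriv_eqI DERIV_sum DERIV_cmult real_polynomial_function_dir_deriv(2) assms)

definition laplacian :: "('a::euclidean_space \<Rightarrow> real) \<Rightarrow> 'a \<Rightarrow> real" where
  "laplacian p x = (\<Sum>b\<in>Basis. dir_deriv b (dir_deriv b p) x)"

lemma real_polynomial_function_laplacian:
  "real_polynomial_function p \<Longrightarrow> real_polynomial_function (laplacian p)"
  unfolding laplacian_def[abs_def] by (intro real_polynomial_function_sum)
    (auto intro: real_polynomial_function_dir_deriv)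

lemma real_polynomial_function_laplacian_funpow:
  "real_polynomial_function p \<Longrightarrow> real_polynomial_function ((laplacian ^^ j) p)"
  by (induction j) (auto intro: real_polynomial_function_laplacian)

lemma laplacian_sum:
  assumes "\<And>i. i \<in> I \<Longrightarrow> real_polynomial_function (p i)"
  shows "laplacian (\<lambda>x. \<Sum>i\<in>I. c i * p i x) = (\<lambda>x. \<Sum>i\<in>I. c i * laplacian (p i) x)"
proof
  fix x
  have "laplacian (\<lambda>x. \<Sum>i\<in>I. c i * p i x) x =
          (\<Sum>b\<in>Basis. \<Sum>i\<in>I. c i * dir_deriv b (dir_deriv b (p i)) x)"
    unfolding laplacian_def
    by (simp add: dir_deriv_sum assms real_polynomial_function_dir_deriv)
  then show "laplacian (\<lambda>x. \<Sum>i\<in>I. c i * p i x) x = (\<Sum>i\<in>I. c i * laplacian (p i) x)"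
    unfolding laplacian_def sum_distrib_left by (simp add: sum.swap[of _ I])
qed

lemma laplacian_funpow_sum:
  assumes "\<And>i. i \<in> I \<Longrightarrow> real_polynomial_function (p i)"
  shows "(laplacian ^^ j) (\<lambda>x. \<Sum>i\<in>I. c i * p i x) =
           (\<lambda>x. \<Sum>i\<in>I. c i * (laplacian ^^ j) (p i) x)"
  by (induction j) (simp_all add: laplacian_sum assms real_polynomial_function_laplacian_funpow)

text \<open>The truncated exponents \<open>i - 1\<close> and \<open>j - 1\<close> are harmless at 0,
  where the factors \<open>real i\<close> and \<open>real j\<close> vanish.\<close>

lemma dir_deriv_inner_powers:
  fixes x :: "'a::euclidean_space"
  shows "dir_deriv b (\<lambda>y. (y \<bullet> y) ^ i * (x \<bullet> y) ^ j) =
    (\<lambda>y. real i * (2 * (y \<bullet> b)) * (y \<bullet> y) ^ (i - 1) * (x \<bullet> y) ^ j +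
         real j * (x \<bullet> b) * (y \<bullet> y) ^ i * (x \<bullet> y) ^ (j - 1))"
  by (intro ext dir_deriv_eqI)
     (auto intro!: derivative_eq_intros simp: inner_simps inner_commute algebra_simps)

text \<open>Terms are grouped by their dependence on \<open>b\<close>: summed over an orthonormal
  basis, the four leading factors become the dimension, \<open>y \<bullet> y\<close>,
  \<open>x \<bullet> y\<close> and \<open>x \<bullet> x\<close>.\<close>

lemma dir_deriv_dir_deriv_inner_powers:
  fixes x :: "'a::euclidean_space"
  shows "dir_deriv b (dir_deriv b (\<lambda>y. (y \<bullet> y) ^ i * (x \<bullet> y) ^ j)) y =
    (b \<bullet> b) * (2 * real i * (y \<bullet> y) ^ (i - 1) * (x \<bullet> y) ^ j) +
    (y \<bullet> b) * (y \<bullet> b) * (4 * real i * real (i - 1) * (y \<bullet> y) ^ (i - 1 - 1) * (x \<bullet> y) ^ j) +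
    (x \<bullet> b) * (y \<bullet> b) * (4 * real i * real j * (y \<bullet> y) ^ (i - 1) * (x \<bullet> y) ^ (j - 1)) +
    (x \<bullet> b) * (x \<bullet> b) * (real j * real (j - 1) * (y \<bullet> y) ^ i * (x \<bullet> y) ^ (j - 1 - 1))"
  unfolding dir_deriv_inner_powers
  by (intro ext dir_deriv_eqI)
     (auto intro!: derivative_eq_intros simp: inner_simps inner_commute algebra_simps)

lemma laplacian_inner_powers:
  fixes x :: "'a::euclidean_space"
  shows "laplacian (\<lambda>y. (y \<bullet> y) ^ i * (x \<bullet> y) ^ j) y =
    2 * real i * (real DIM('a) + 2 * real i + 2 * real j - 2) * (y \<bullet> y) ^ (i - 1) * (x \<bullet> y) ^ j +
    real j * (real j - 1) * (x \<bullet> x) * (y \<bullet> y) ^ i * (x \<bullet> y) ^ (j - 2)"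
proof -
  have lap: "laplacian (\<lambda>y. (y \<bullet> y) ^ i * (x \<bullet> y) ^ j) y =
    real DIM('a) * (2 * real i * (y \<bullet> y) ^ (i - 1) * (x \<bullet> y) ^ j) +
    (y \<bullet> y) * (4 * real i * real (i - 1) * (y \<bullet> y) ^ (i - 1 - 1) * (x \<bullet> y) ^ j) +
    (x \<bullet> y) * (4 * real i * real j * (y \<bullet> y) ^ (i - 1) * (x \<bullet> y) ^ (j - 1)) +
    (x \<bullet> x) * (real j * real (j - 1) * (y \<bullet> y) ^ i * (x \<bullet> y) ^ (j - 1 - 1))"
    unfolding laplacian_def dir_deriv_dir_deriv_inner_powers sum.distrib sum_distrib_right[symmetric]
      euclidean_inner[symmetric] by simp
  \<comment> \<open>The outer factors are absorbed into the powers. Wherever truncated subtraction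
    would spoil the identities, one of the factors \<open>real i\<close>,
    \<open>real (i - 1)\<close>, \<open>real j\<close> is zero.\<close>
  have e1: "(y \<bullet> y) * (4 * real i * real (i - 1) * (y \<bullet> y) ^ (i - 1 - 1) * (x \<bullet> y) ^ j) =
      4 * real i * (real i - 1) * (y \<bullet> y) ^ (i - 1) * (x \<bullet> y) ^ j"
  proof (cases i)
    case (Suc n)
    then show ?thesis by (cases n) (simp_all add: algebra_simps)
  qed simp
  have e2: "(x \<bullet> y) * (4 * real i * real j * (y \<bullet> y) ^ (i - 1) * (x \<bullet> y) ^ (j - 1)) =
      4 * real i * real j * (y \<bullet> y) ^ (i - 1) * (x \<bullet> y) ^ j"
    by (cases j) (simp_all add: algebra_simps)
  have e3: "(x \<bullet> x) * (real j * real (j - 1) * (y \<bullet> y) ^ i * (x \<bullet> y) ^ (j - 1 - 1)) =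
      real j * (real j - 1) * (x \<bullet> x) * (y \<bullet> y) ^ i * (x \<bullet> y) ^ (j - 2)"
    by (cases j) (simp_all add: numeral_2_eq_2)
  show ?thesis unfolding lap e1 e2 e3 by (simp add: algebra_simps)
qed

text \<open>Each Laplacian turns \<open>(x \<bullet> y) ^ n\<close> into
  \<open>n * (n - 1) * (x \<bullet> x) * (x \<bullet> y) ^ (n - 2)\<close>, and the numerical
  factors multiply up to a quotient of factorials.\<close>

lemma laplacian_funpow_inner_power:
  fixes x :: "'a::euclidean_space"
  assumes "2 * j \<le> l"
  shows "(laplacian ^^ j) (\<lambda>y. (x \<bullet> y) ^ l) =
           (\<lambda>y. fact l / fact (l - 2 * j) * (x \<bullet> x) ^ j * (x \<bullet> y) ^ (l - 2 * j))"
  using assms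
proof (induction j)
  case 0
  then show ?case by simp
next
  case (Suc j)
  then obtain q where l: "l = Suc (Suc (q + 2 * j))"
    by (auto dest!: le_Suc_ex simp: ac_simps)
  have pol: "real_polynomial_function (\<lambda>y. (x \<bullet> y) ^ n)" for n
    by (auto intro: bounded_linear_inner_right)
  define c where "c = fact l / fact (Suc (Suc q)) * (x \<bullet> x) ^ j"
  \<comment> \<open>The scalar multiple is written as a sum over a one-element set so that
    \<open>laplacian_sum\<close> pulls out the constant.\<close>
  have "(laplacian ^^ Suc j) (\<lambda>y. (x \<bullet> y) ^ l) =
          laplacian (\<lambda>y. \<Sum>i\<in>{()}. c * (x \<bullet> y) ^ Suc (Suc q))"
    using Suc by (simp add: l c_def)
  also have "\<dots> = (\<lambda>y. c * laplacian (\<lambda>y. (x \<bullet> y) ^ Suc (Suc q)) y)"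
    using laplacian_sum[of "{()}" "\<lambda>_ y. (x \<bullet> y) ^ Suc (Suc q)" "\<lambda>_. c"] pol[of "Suc (Suc q)"] by simp
  also have "laplacian (\<lambda>y. (x \<bullet> y) ^ Suc (Suc q)) = (\<lambda>y. real (Suc (Suc q)) * real (Suc q) * (x \<bullet> x) * (x \<bullet> y) ^ q)"
    using laplacian_inner_powers[of 0 x "Suc (Suc q)"] by (simp add: fun_eq_iff)
  finally show ?case
    by (simp add: l c_def field_simps del: of_nat_Suc)
qed

section \<open>Explicit Gegenbauer polynomials and their harmonic homogenization\<close>

definition gegenbauer_coeff :: "real \<Rightarrow> nat \<Rightarrow> nat \<Rightarrow> real" where
  "gegenbauer_coeff \<alpha> l j =
     (- 1) ^ j * pochhammer \<alpha> (l - j) * 2 ^ (l - 2 * j) / (fact j * fact (l - 2 * j))"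

text \<open>The inner power series factors as \<open>fps_X * (fps_X - 2 * t)\<close>, so the
  binomial theorem gives the coefficients of its \<open>i\<close>-th power. Only
  \<open>i \<le> l\<close> contributes to degree \<open>l\<close>, and \<open>j = l - i\<close>
  indexes the classical closed form.\<close>

lemma gegenbauer_eq_sum:
  "gegenbauer \<alpha> l t = (\<Sum>j\<le>l div 2. gegenbauer_coeff \<alpha> l j * t ^ (l - 2 * j))"
proof -
  have fac: "(fps_X ^ 2 - fps_const (2 * t) * fps_X) ^ i =
          fps_X ^ i * (fps_X + fps_const (- (2 * t))) ^ i" for i
    by (simp add: power2_eq_square algebra_simps flip: power_mult_distrib)
  \<comment> \<open>For \<open>n > i\<close> the exponent truncates to 0, but the binomial
    coefficient is 0 as well.\<close>
  have nth: "fps_nth ((fps_X + fps_const c) ^ i) n = real (i choose n) * c ^ (i - n)" for c :: real and i n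
  proof -
    have "fps_nth ((fps_X + fps_const c) ^ i) n =
            (\<Sum>k\<le>i. if n = k then real (i choose k) * c ^ (i - k) else 0)"
      unfolding binomial_ring fps_sum_nth
      by (intro sum.cong refl)
         (auto simp: fps_const_power mult.assoc fps_of_nat[symmetric] fps_X_power_mult_nth
           simp del: fps_of_nat)
    then show ?thesis
      by (auto simp: binomial_eq_0)
  qed
  have "gegenbauer \<alpha> l t = (\<Sum>i\<le>l. (- \<alpha> gchoose i) * (if l < i then 0 else
          real (i choose (l - i)) * (- (2 * t)) ^ (i - (l - i))))"
    unfolding gegenbauer_def fps_compose_nth fac
    by (simp add: fps_X_power_mult_nth nth atLeast0AtMost)
  also have "\<dots> = (\<Sum>j\<le>l. (- \<alpha> gchoose (l - j)) * (real ((l - j) choose j) * (- (2 * t)) ^ (l - j - j)))"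
    by (rule sum.reindex_bij_witness[of _ "\<lambda>j. l - j" "\<lambda>i. l - i"]) auto
  \<comment> \<open>Beyond \<open>l div 2\<close> the binomial coefficient vanishes because
    \<open>l - j < j\<close>.\<close>
  also have "\<dots> = (\<Sum>j\<le>l div 2. (- \<alpha> gchoose (l - j)) * (real ((l - j) choose j) * (- (2 * t)) ^ (l - j - j)))"
    by (rule sum.mono_neutral_right) (auto simp: binomial_eq_0)
  also have "\<dots> = (\<Sum>j\<le>l div 2. gegenbauer_coeff \<alpha> l j * t ^ (l - 2 * j))"
  proof (intro sum.cong refl)
    fix j assume "j \<in> {..l div 2}"
    then have "2 * j \<le> l" by auto
    then obtain q where l: "l = 2 * j + q"
      using le_Suc_ex by blast
    have bin: "real ((j + q) choose j) = fact (j + q) / (fact j * fact q)"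
      using binomial_fact[of j "j + q", where 'a = real] by simp
    have pow: "(- (2 * t)) ^ q = (- 1) ^ q * (2 ^ q * t ^ q)"
      using power_minus[of "2 * t" q] by (simp add: power_mult_distrib)
    \<comment> \<open>One sign comes from the generalized binomial with upper entry
      \<open>- \<alpha>\<close>, the other from the power of \<open>- (2 * t)\<close>.\<close>
    have sgn: "(- 1) ^ (j + q) * (- 1) ^ q = (- 1 :: real) ^ j"
      by (simp add: power_add flip: power_mult_distrib)
    have d: "l - j = j + q" "j + q - j = q" "l - 2 * j = q"
      by (simp_all add: l)
    have "(- 1) ^ (j + q) * pochhammer \<alpha> (j + q) / fact (j + q) *
        (fact (j + q) / (fact j * fact q) * ((- 1) ^ q * (2 ^ q * t ^ q))) =
        ((- 1) ^ (j + q) * (- 1) ^ q) * (pochhammer \<alpha> (j + q) * 2 ^ q / (fact j * fact q) * t ^ q)"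
      by simp
    then show "(- \<alpha> gchoose (l - j)) * (real ((l - j) choose j) * (- (2 * t)) ^ (l - j - j)) =
        gegenbauer_coeff \<alpha> l j * t ^ (l - 2 * j)"
      unfolding gegenbauer_coeff_def gbinomial_pochhammer d bin pow sgn by simp
  qed
  finally show ?thesis .
qed

text \<open>The two Pochhammer symbols differ by the factor
  \<open>\<alpha> + real l - real (Suc j)\<close>, the powers of 2 by 4, and the factorials account
  for the rest. This is the cancellation that makes the homogenized polynomial harmonic.\<close>

lemma gegenbauer_coeff_Suc:
  assumes "2 * Suc j \<le> l"
  shows "gegenbauer_coeff \<alpha> l (Suc j) * (4 * real (Suc j) * (\<alpha> + real l - real (Suc j))) =
           - gegenbauer_coeff \<alpha> l j * (real (l - 2 * j) * (real (l - 2 * j) - 1))"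
proof -
  obtain q where l: "l = 2 * Suc j + q"
    using assms le_Suc_ex by blast
  have d: "l - Suc j = Suc (j + q)" "l - 2 * Suc j = q" "l - j = Suc (Suc (j + q))" "l - 2 * j = Suc (Suc q)"
    by (simp_all add: l)
  define z where "z = \<alpha> + real (Suc (j + q))"
  have z: "\<alpha> + real l - real (Suc j) = z"
    by (simp add: l z_def)
  have q: "real (Suc (Suc q)) - 1 = real (Suc q)"
    by simp
  show ?thesis
    unfolding gegenbauer_coeff_def d z q pochhammer_Suc[of \<alpha> "Suc (j + q)"] z_def[symmetric] fact_Suc
    by (simp add: field_simps del: of_nat_Suc)
qed

lemma gegenbauer_coeff_0_pos: "\<alpha> > 0 \<Longrightarrow> gegenbauer_coeff \<alpha> l 0 > 0"
  by (simp add: gegenbauer_coeff_def pochhammer_pos)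

text \<open>For nonzero \<open>x\<close> and \<open>y\<close> this is
  \<open>norm x ^ l * norm y ^ l\<close> times the Gegenbauer polynomial at the cosine of the angle
  between them; it is homogeneous of degree \<open>l\<close> in each variable.\<close>

definition gegenbauer_hom :: "real \<Rightarrow> nat \<Rightarrow> 'a::euclidean_space \<Rightarrow> 'a \<Rightarrow> real" where
  "gegenbauer_hom \<alpha> l x y =
     (\<Sum>j\<le>l div 2. gegenbauer_coeff \<alpha> l j * (x \<bullet> x) ^ j * ((y \<bullet> y) ^ j * (x \<bullet> y) ^ (l - 2 * j)))"

lemma gegenbauer_hom_unit:
  "norm x = 1 \<Longrightarrow> norm y = 1 \<Longrightarrow> gegenbauer_hom \<alpha> l x y = gegenbauer \<alpha> l (x \<bullet> y)"
  by (simp add: gegenbauer_hom_def gegenbauer_eq_sum dot_square_norm)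

lemma real_polynomial_function_inner_powers:
  fixes x :: "'a::euclidean_space"
  shows "real_polynomial_function (\<lambda>y. (y \<bullet> y) ^ i * (x \<bullet> y) ^ j)"
proof -
  \<comment> \<open>Polynomial functions are generated by linear ones, so
    \<open>y \<bullet> y\<close> is first written in coordinates.\<close>
  have "real_polynomial_function (\<lambda>y. (\<Sum>b\<in>Basis. (y \<bullet> b) * (y \<bullet> b)) ^ i * (x \<bullet> y) ^ j)"
    by (intro real_polynomial_function.intros(4) real_polynomial_function_power real_polynomial_function_sum)
       (auto intro: bounded_linear_inner_right bounded_linear_inner_left)
  then show ?thesis
    by (simp flip: euclidean_inner)
qed

text \<open>The Laplacian splits the \<open>j\<close>-th summand into \<open>u j\<close> and
  \<open>v j\<close>; as the dimension is \<open>2 * \<alpha> + 2\<close>, the recurrence for the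
  coefficients makes \<open>u (Suc j)\<close> cancel \<open>v j\<close>. At the ends,
  \<open>u 0\<close> carries the factor 0, and \<open>v N\<close> vanishes since
  \<open>l - 2 * N\<close> is 0 or 1.\<close>

lemma laplacian_gegenbauer_hom:
  fixes x :: "'a::euclidean_space"
  assumes "\<alpha> = (real DIM('a) - 2) / 2"
  shows "laplacian (gegenbauer_hom \<alpha> l x) = (\<lambda>_. 0)"
proof
  fix y
  define N where "N = l div 2"
  define c where "c j = gegenbauer_coeff \<alpha> l j" for j
  define u where "u j = c j * (x \<bullet> x) ^ j *
    (4 * real j * (\<alpha> + real l - real j) * (y \<bullet> y) ^ (j - 1) * (x \<bullet> y) ^ (l - 2 * j))" for j
  define v where "v j = c j * (x \<bullet> x) ^ j *
    (real (l - 2 * j) * (real (l - 2 * j) - 1) * (x \<bullet> x) * (y \<bullet> y) ^ j * (x \<bullet> y) ^ (l - 2 * j - 2))" for j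
  have "laplacian (gegenbauer_hom \<alpha> l x) y =
      (\<Sum>j\<le>N. c j * (x \<bullet> x) ^ j * laplacian (\<lambda>y. (y \<bullet> y) ^ j * (x \<bullet> y) ^ (l - 2 * j)) y)"
    unfolding gegenbauer_hom_def[abs_def] N_def c_def
    by (subst laplacian_sum) (auto intro: real_polynomial_function_inner_powers)
  also have "\<dots> = (\<Sum>j\<le>N. u j + v j)"
  proof (intro sum.cong refl)
    fix j assume "j \<in> {..N}"
    then have "2 * j \<le> l" by (auto simp: N_def)
    then have "2 * real j * (real DIM('a) + 2 * real j + 2 * real (l - 2 * j) - 2) =
        4 * real j * (\<alpha> + real l - real j)"
      by (simp add: assms of_nat_diff field_simps)
    then show "c j * (x \<bullet> x) ^ j * laplacian (\<lambda>y. (y \<bullet> y) ^ j * (x \<bullet> y) ^ (l - 2 * j)) y = u j + v j"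
      unfolding laplacian_inner_powers u_def v_def by (simp only: distrib_left)
  qed
  also have "\<dots> = (\<Sum>j\<le>N. u j) + (\<Sum>j\<le>N. v j)"
    by (rule sum.distrib)
  also have "(\<Sum>j\<le>N. u j) = (\<Sum>j<N. u (Suc j))"
    by (simp add: sum.atMost_shift u_def)
  also have "(\<Sum>j\<le>N. v j) = (\<Sum>j<N. v j)"
  proof -
    have "l - 2 * N = 0 \<or> l - 2 * N = 1" by (auto simp: N_def)
    then have "v N = 0" by (auto simp: v_def)
    then show ?thesis by (simp add: lessThan_Suc_atMost[symmetric])
  qed
  also have "(\<Sum>j<N. u (Suc j)) + (\<Sum>j<N. v j) = (\<Sum>j<N. u (Suc j) + v j)"
    by (rule sum.distrib[symmetric])
  also have "\<dots> = 0"
  proof (intro sum.neutral ballI)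
    fix j assume "j \<in> {..<N}"
    then have j: "2 * Suc j \<le> l" by (auto simp: N_def)
    have e: "l - 2 * j - 2 = l - 2 * Suc j" by simp
    have "u (Suc j) = c (Suc j) * (4 * real (Suc j) * (\<alpha> + real l - real (Suc j))) *
        ((x \<bullet> x) ^ Suc j * (y \<bullet> y) ^ j * (x \<bullet> y) ^ (l - 2 * Suc j))"
      unfolding u_def by (simp only: diff_Suc_1 mult_ac)
    moreover have "v j = c j * (real (l - 2 * j) * (real (l - 2 * j) - 1)) *
        ((x \<bullet> x) ^ Suc j * (y \<bullet> y) ^ j * (x \<bullet> y) ^ (l - 2 * Suc j))"
      unfolding v_def e by (simp only: power_Suc mult_ac)
    ultimately show "u (Suc j) + v j = 0"
      using gegenbauer_coeff_Suc[OF j, of \<alpha>] unfolding c_def by simp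
  qed
  finally show "laplacian (gegenbauer_hom \<alpha> l x) y = 0" .
qed

section \<open>Harmonic projection and an addition formula\<close>

definition harmonic_part :: "real \<Rightarrow> nat \<Rightarrow> ('a::euclidean_space \<Rightarrow> real) \<Rightarrow> 'a \<Rightarrow> real" where
  "harmonic_part \<alpha> l p y = (\<Sum>j\<le>l div 2.
     gegenbauer_coeff \<alpha> l j * (fact (l - 2 * j) / fact l) * (y \<bullet> y) ^ j * (laplacian ^^ j) p y)"

lemma harmonic_part_sum:
  assumes "\<And>i. i \<in> I \<Longrightarrow> real_polynomial_function (p i)"
  shows "harmonic_part \<alpha> l (\<lambda>x. \<Sum>i\<in>I. c i * p i x) y = (\<Sum>i\<in>I. c i * harmonic_part \<alpha> l (p i) y)"
proof -
  have "(laplacian ^^ j) (\<lambda>x. \<Sum>i\<in>I. c i * p i x) = (\<lambda>x. \<Sum>i\<in>I. c i * (laplacian ^^ j) (p i) x)" for j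
    by (rule laplacian_funpow_sum) (rule assms)
  moreover have "(\<Sum>i\<in>I. c i * harmonic_part \<alpha> l (p i) y) = (\<Sum>j\<le>l div 2. \<Sum>i\<in>I. c i *
      (gegenbauer_coeff \<alpha> l j * (fact (l - 2 * j) / fact l) * (y \<bullet> y) ^ j * (laplacian ^^ j) (p i) y))"
    unfolding harmonic_part_def sum_distrib_left by (rule sum.swap)
  ultimately show ?thesis
    unfolding harmonic_part_def[of _ _ "\<lambda>x. \<Sum>i\<in>I. c i * p i x"]
    by (simp add: sum_distrib_left sum_divide_distrib mult_ac)
qed

text \<open>The weights \<open>fact (l - 2 * j) / fact l\<close> in \<open>harmonic_part\<close> are
  chosen to cancel the factorials produced by the iterated Laplacian.\<close>

lemma harmonic_part_inner_power:
  "harmonic_part \<alpha> l (\<lambda>y. (x \<bullet> y) ^ l) y = gegenbauer_hom \<alpha> l x y"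
  unfolding harmonic_part_def gegenbauer_hom_def
  by (intro sum.cong refl) (subst laplacian_funpow_inner_power; auto)

text \<open>All terms with \<open>j > 0\<close> contain a Laplacian of \<open>p\<close>, so only the
  leading term survives.\<close>

lemma harmonic_part_harmonic:
  assumes "laplacian p = (\<lambda>_. 0)"
  shows "harmonic_part \<alpha> l p y = gegenbauer_coeff \<alpha> l 0 * p y"
proof -
  have "laplacian (\<lambda>_::'a. 0) = (\<lambda>_. 0)"
    by (simp add: laplacian_def[abs_def] dir_deriv_def)
  then have "(laplacian ^^ Suc j) p = (\<lambda>_. 0)" for j
    by (induction j) (simp_all add: assms)
  then have "harmonic_part \<alpha> l p y = (\<Sum>j\<le>l div 2. if j = 0 then gegenbauer_coeff \<alpha> l 0 * p y else 0)"
    unfolding harmonic_part_def by (intro sum.cong refl) (auto simp: gr0_conv_Suc)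
  then show ?thesis by simp
qed

text \<open>Projecting the expansion of \<open>(x \<bullet> y) ^ l\<close> in \<open>y\<close>
  replaces \<open>e g y\<close> by \<open>h g y\<close>. By symmetry the variables may be exchanged,
  and a second projection replaces the remaining \<open>e g\<close>, while the already harmonic left
  side is only multiplied by \<open>c\<close>.\<close>

lemma gegenbauer_inner_decomposition:
  assumes \<alpha>: "\<alpha> = (real DIM('a::euclidean_space) - 2) / 2" "\<alpha> > 0"
  shows "\<exists>F (Y :: (nat \<Rightarrow> 'a) \<Rightarrow> 'a \<Rightarrow> real). finite F \<and>
    (\<forall>x y. norm x = 1 \<longrightarrow> norm y = 1 \<longrightarrow> gegenbauer \<alpha> l (x \<bullet> y) = (\<Sum>i\<in>F. Y i x * Y i y))"
proof -
  \<comment> \<open>Words of length \<open>l\<close> in basis vectors index the expanded product.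
    Repetition of the same monomial under different words absorbs the multinomial
    coefficients.\<close>
  define F where "F = ({..<l} \<rightarrow>\<^sub>E Basis :: (nat \<Rightarrow> 'a) set)"
  define e where "e g x = (\<Prod>i<l. x \<bullet> g i)" for g :: "nat \<Rightarrow> 'a" and x
  define h where "h = harmonic_part \<alpha> l \<circ> e"
  define c where "c = gegenbauer_coeff \<alpha> l 0"
  have "finite F"
    unfolding F_def by (intro finite_PiE) auto
  have pol: "real_polynomial_function (e g)" for g
    unfolding e_def by (intro real_polynomial_function_prod) (auto intro: bounded_linear_inner_left)
  have expand: "(x \<bullet> y) ^ l = (\<Sum>g\<in>F. e g x * e g y)" for x y
  proof -
    have "(x \<bullet> y) ^ l = (\<Prod>i<l. \<Sum>b\<in>Basis. (x \<bullet> b) * (y \<bullet> b))"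
      by (simp flip: euclidean_inner)
    also have "\<dots> = (\<Sum>g\<in>F. \<Prod>i<l. (x \<bullet> g i) * (y \<bullet> g i))"
      unfolding F_def by (rule prod_sum_PiE) auto
    finally show ?thesis
      by (simp add: e_def prod.distrib)
  qed
  have hom: "gegenbauer_hom \<alpha> l x y = (\<Sum>g\<in>F. e g x * h g y)" for x y
    unfolding harmonic_part_inner_power[symmetric] expand h_def o_def
    by (rule harmonic_part_sum[OF pol])
  have sym: "gegenbauer_hom \<alpha> l x = (\<lambda>y. gegenbauer_hom \<alpha> l y x)" for x :: 'a
    by (simp add: gegenbauer_hom_def inner_commute mult_ac fun_eq_iff)
  have "c * gegenbauer_hom \<alpha> l x y = (\<Sum>g\<in>F. h g x * h g y)" for x y
  proof -
    have "c * gegenbauer_hom \<alpha> l x y = harmonic_part \<alpha> l (gegenbauer_hom \<alpha> l x) y"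
      unfolding c_def by (rule harmonic_part_harmonic[OF laplacian_gegenbauer_hom[OF \<alpha>(1)], symmetric])
    also have "\<dots> = harmonic_part \<alpha> l (\<lambda>y. \<Sum>g\<in>F. h g x * e g y) y"
      unfolding sym[of x] hom by (simp add: mult.commute)
    also have "\<dots> = (\<Sum>g\<in>F. h g x * h g y)"
      unfolding h_def o_def by (rule harmonic_part_sum[OF pol])
    finally show ?thesis .
  qed
  \<comment> \<open>Positivity lets the constant be shared as \<open>sqrt c\<close> by the two
    factors, keeping the decomposition symmetric.\<close>
  moreover have "c > 0"
    unfolding c_def by (rule gegenbauer_coeff_0_pos[OF \<alpha>(2)])
  ultimately have "gegenbauer \<alpha> l (x \<bullet> y) = (\<Sum>g\<in>F. (h g x / sqrt c) * (h g y / sqrt c))"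
    if "norm x = 1" "norm y = 1" for x y
    using that \<open>c > 0\<close> by (simp add: gegenbauer_hom_unit[symmetric] field_simps flip: sum_divide_distrib)
  with \<open>finite F\<close> show ?thesis
    by (intro exI[of _ F] exI[of _ "\<lambda>g x. h g x / sqrt c"] conjI allI impI)
qed

section \<open>Strict positive definiteness in terms of weights on finite point sets\<close>

lemma strictly_pos_def_kernel_zeroD:
  assumes "strictly_pos_def_kernel X K" "finite S" "S \<subseteq> X"
    and "(\<Sum>u\<in>S. \<Sum>v\<in>S. c u * c v * K u v) = 0" and "u \<in> S"
  shows "c u = 0"
proof (rule ccontr)
  assume "c u \<noteq> 0"
  obtain h where h: "bij_betw h {1..card S} S"
    using ex_bij_betw_nat_finite_1[OF \<open>finite S\<close>] by blast
  define d where "d i = c (h i)" for i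
  obtain i where i: "i \<in> {1..card S}" "h i = u"
    using h \<open>u \<in> S\<close> by (metis bij_betw_imp_surj_on imageE)
  have "(\<Sum>i=1..card S. \<Sum>j=1..card S. d i * d j * K (h i) (h j)) > 0"
  proof -
    have "inj_on h {1..card S}" "h ` {1..card S} \<subseteq> X" "card S \<ge> 1"
      using h \<open>S \<subseteq> X\<close> i by (auto simp: bij_betw_def)
    moreover have "\<exists>i\<in>{1..card S}. d i \<noteq> 0"
      using i \<open>c u \<noteq> 0\<close> by (auto simp: d_def)
    ultimately show ?thesis
      using assms(1)[unfolded strictly_pos_def_kernel_def, THEN conjunct2, rule_format,
          of "card S" h d] by blast
  qed
  moreover have "(\<Sum>i=1..card S. \<Sum>j=1..card S. d i * d j * K (h i) (h j)) =
      (\<Sum>u\<in>S. \<Sum>v\<in>S. c u * c v * K u v)"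
  proof -
    have "(\<Sum>j=1..card S. c u * d j * K u (h j)) = (\<Sum>v\<in>S. c u * c v * K u v)" for u
      unfolding d_def by (rule sum.reindex_bij_betw[OF h, of "\<lambda>v. c u * c v * K u v"])
    then have "(\<Sum>i=1..card S. \<Sum>j=1..card S. d i * d j * K (h i) (h j)) =
        (\<Sum>i=1..card S. (\<lambda>u. \<Sum>v\<in>S. c u * c v * K u v) (h i))"
      by (simp add: d_def)
    also have "\<dots> = (\<Sum>u\<in>S. \<Sum>v\<in>S. c u * c v * K u v)"
      by (rule sum.reindex_bij_betw[OF h])
    finally show ?thesis .
  qed
  ultimately show False
    unfolding assms(4) by (simp only: less_irrefl)
qed

text \<open>Negative values are already excluded by \<open>pos_def_kernel\<close>, so it suffices to
  exclude 0. Inverting the injective enumeration carries its weights over to the points.\<close>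

lemma strictly_pos_def_kernelI:
  assumes "pos_def_kernel X K"
    and "\<And>S c u. finite S \<Longrightarrow> S \<subseteq> X \<Longrightarrow> (\<Sum>u\<in>S. \<Sum>v\<in>S. c u * c v * K u v) = 0 \<Longrightarrow> u \<in> S \<Longrightarrow> c u = 0"
  shows "strictly_pos_def_kernel X K"
  unfolding strictly_pos_def_kernel_def
proof (intro conjI allI impI assms(1); elim conjE bexE)
  fix n i :: nat and u :: "nat \<Rightarrow> 'a" and c :: "nat \<Rightarrow> real"
  assume n: "n \<ge> 1" and inj: "inj_on u {1..n}" and X: "u ` {1..n} \<subseteq> X"
    and i: "i \<in> {1..n}" "c i \<noteq> 0"
  define d where "d v = c (the_inv_into {1..n} u v)" for v
  have d: "d (u j) = c j" if "j \<in> {1..n}" for j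
    using the_inv_into_f_f[OF inj that] by (simp add: d_def)
  have eq: "(\<Sum>v\<in>u ` {1..n}. \<Sum>w\<in>u ` {1..n}. d v * d w * K v w) =
      (\<Sum>\<mu>=1..n. \<Sum>\<nu>=1..n. c \<mu> * c \<nu> * K (u \<mu>) (u \<nu>))"
    unfolding sum.reindex[OF inj] by (simp add: d)
  have "(\<Sum>v\<in>u ` {1..n}. \<Sum>w\<in>u ` {1..n}. d v * d w * K v w) \<noteq> 0"
    using assms(2)[of "u ` {1..n}" d "u i"] X i d[OF i(1)] by auto
  moreover have "(\<Sum>\<mu>=1..n. \<Sum>\<nu>=1..n. c \<mu> * c \<nu> * K (u \<mu>) (u \<nu>)) \<ge> 0"
    using assms(1) n inj X unfolding pos_def_kernel_def by blast
  ultimately show "(\<Sum>\<mu>=1..n. \<Sum>\<nu>=1..n. c \<mu> * c \<nu> * K (u \<mu>) (u \<nu>)) > 0"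
    unfolding eq by simp
qed

section \<open>Quadratic forms of the polynomials on the circle and the sphere\<close>

lemma inner_unit_mem: "norm x = 1 \<Longrightarrow> norm y = 1 \<Longrightarrow> x \<bullet> y \<in> {- 1..1}"
  using Cauchy_Schwarz_ineq2[of x y] by (simp add: abs_le_iff)

text \<open>The form of a witness \<open>g\<close> is the series of the forms of
  \<open>a l * P l\<close>. Each term vanishes, either because \<open>a l = 0\<close> or because
  \<open>l \<in> I\<close>, so strictness of the kernel of \<open>g\<close> applies.\<close>

lemma SPD_zeroD:
  fixes X :: "(real ^ 'n::finite) set"
  assumes "I \<in> SPD TYPE('n)" "finite X" "X \<subseteq> sphere 0 1"
    and zero: "\<And>l. l \<in> I \<Longrightarrow> (\<Sum>x\<in>X. \<Sum>y\<in>X. c x * c y * sphere_poly (CARD('n) - 1) l (x \<bullet> y)) = 0"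
    and "x \<in> X"
  shows "c x = 0"
proof -
  let ?P = "sphere_poly (CARD('n) - 1)"
  obtain g a where spd: "strictly_pos_def_kernel (sphere (0 :: real ^ 'n) 1) (\<lambda>z w. g (z \<bullet> w))"
    and a: "sphere_expansion (CARD('n) - 1) g a" "{l. a l > 0} = I"
    using assms(1) unfolding SPD_def by blast
  have sums: "(\<lambda>l. a l * ?P l (x \<bullet> y)) sums g (x \<bullet> y)" if "x \<in> X" "y \<in> X" for x y
  proof -
    have "x \<bullet> y \<in> {- 1..1}"
      using that assms(3) by (intro inner_unit_mem) auto
    then show ?thesis
      using a(1) unfolding sphere_expansion_def by blast
  qed
  have "(\<lambda>l. \<Sum>x\<in>X. \<Sum>y\<in>X. c x * c y * (a l * ?P l (x \<bullet> y))) sums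
      (\<Sum>x\<in>X. \<Sum>y\<in>X. c x * c y * g (x \<bullet> y))"
    by (intro sums_sum sums_mult sums)
  moreover have "(\<Sum>x\<in>X. \<Sum>y\<in>X. c x * c y * (a l * ?P l (x \<bullet> y))) = 0" for l
  proof -
    have "(\<Sum>x\<in>X. \<Sum>y\<in>X. c x * c y * (a l * ?P l (x \<bullet> y))) =
        a l * (\<Sum>x\<in>X. \<Sum>y\<in>X. c x * c y * ?P l (x \<bullet> y))"
      by (simp add: sum_distrib_left mult_ac)
    moreover have "a l \<ge> 0"
      using a(1) unfolding sphere_expansion_def by blast
    then have "a l = 0 \<or> l \<in> I"
      unfolding a(2)[symmetric] mem_Collect_eq by linarith
    then have "a l * (\<Sum>x\<in>X. \<Sum>y\<in>X. c x * c y * ?P l (x \<bullet> y)) = 0"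
      using zero[of l] by (elim disjE) (simp_all only: mult_zero_left mult_zero_right)
    ultimately show ?thesis
      by (simp only:)
  qed
  ultimately have "(\<lambda>_. 0) sums (\<Sum>x\<in>X. \<Sum>y\<in>X. c x * c y * g (x \<bullet> y))"
    by (simp only:)
  then have "(\<Sum>x\<in>X. \<Sum>y\<in>X. c x * c y * g (x \<bullet> y)) = 0"
    by (rule sums_unique2[OF _ sums_zero])
  then show ?thesis
    by (rule strictly_pos_def_kernel_zeroD[OF spd assms(2,3) _ \<open>x \<in> X\<close>])
qed

text \<open>In angular coordinates the addition formula for the cosine turns the form into a
  nonnegative multiple of a sum of two squares.\<close>

lemma sphere_poly_1_nonneg:
  fixes X :: "(real ^ 2) set"
  assumes "X \<subseteq> sphere 0 1"
  shows "(\<Sum>x\<in>X. \<Sum>y\<in>X. c x * c y * sphere_poly 1 k (x \<bullet> y)) \<ge> 0"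
proof (cases "k = 0")
  case True
  then have "(\<Sum>x\<in>X. \<Sum>y\<in>X. c x * c y * sphere_poly 1 k (x \<bullet> y)) = (\<Sum>x\<in>X. c x)\<^sup>2"
    unfolding power2_eq_square sum_product by (simp add: sphere_poly_def)
  then show ?thesis
    by simp
next
  case False
  have "\<exists>\<theta>. x $ 1 = cos \<theta> \<and> x $ 2 = sin \<theta>" if "x \<in> X" for x
  proof -
    have "x \<bullet> x = 1"
      using assms that by (auto simp: dot_square_norm)
    then have "(x $ 1)\<^sup>2 + (x $ 2)\<^sup>2 = 1"
      by (simp add: inner_vec_def sum_2 power2_eq_square)
    then show ?thesis
      using sincos_total_2pi by blast
  qed
  then obtain \<theta> where \<theta>: "\<And>x. x \<in> X \<Longrightarrow> x $ 1 = cos (\<theta> x) \<and> x $ 2 = sin (\<theta> x)"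
    by metis
  have "(\<Sum>x\<in>X. \<Sum>y\<in>X. c x * c y * sphere_poly 1 k (x \<bullet> y)) = (\<Sum>x\<in>X. \<Sum>y\<in>X. 2 / real k *
      ((c x * cos (real k * \<theta> x)) * (c y * cos (real k * \<theta> y)) +
       (c x * sin (real k * \<theta> x)) * (c y * sin (real k * \<theta> y))))"
  proof (intro sum.cong refl)
    fix x y assume "x \<in> X" "y \<in> X"
    then have "x \<bullet> y = cos (\<theta> x - \<theta> y)"
      by (simp add: inner_vec_def sum_2 \<theta> cos_diff)
    then have "sphere_poly 1 k (x \<bullet> y) = 2 / real k * cos (real k * \<theta> x - real k * \<theta> y)"
      using False by (simp add: sphere_poly_1_cos[unfolded One_nat_def] right_diff_distrib)
    then show "c x * c y * sphere_poly 1 k (x \<bullet> y) = 2 / real k *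
      ((c x * cos (real k * \<theta> x)) * (c y * cos (real k * \<theta> y)) +
       (c x * sin (real k * \<theta> x)) * (c y * sin (real k * \<theta> y)))"
      by (simp add: cos_diff algebra_simps)
  qed
  also have "\<dots> = 2 / real k * ((\<Sum>x\<in>X. \<Sum>y\<in>X. (c x * cos (real k * \<theta> x)) * (c y * cos (real k * \<theta> y))) +
      (\<Sum>x\<in>X. \<Sum>y\<in>X. (c x * sin (real k * \<theta> x)) * (c y * sin (real k * \<theta> y))))"
    unfolding sum.distrib[symmetric] sum_distrib_left by (rule refl)
  also have "\<dots> = 2 / real k * ((\<Sum>x\<in>X. c x * cos (real k * \<theta> x))\<^sup>2 + (\<Sum>x\<in>X. c x * sin (real k * \<theta> x))\<^sup>2)"
    unfolding power2_eq_square sum_product by (rule refl)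
  finally show ?thesis
    by simp
qed

text \<open>In dimension \<open>m + 1\<close> the harmonic parameter is
  \<open>(real m - 1) / 2\<close>, which is positive for \<open>m \<ge> 2\<close>.\<close>

lemma sphere_poly_inner_decomposition:
  assumes "CARD('n::finite) = m + 1" "m \<ge> 2"
  shows "\<exists>F (Y :: (nat \<Rightarrow> real ^ 'n) \<Rightarrow> real ^ 'n \<Rightarrow> real). finite F \<and>
    (\<forall>z w. norm z = 1 \<longrightarrow> norm w = 1 \<longrightarrow> sphere_poly m l (z \<bullet> w) = (\<Sum>i\<in>F. Y i z * Y i w))"
  using gegenbauer_inner_decomposition[where 'a = "real ^ 'n" and \<alpha> = "(real m - 1) / 2"] assms
  by (simp add: sphere_poly_def)

section \<open>Vanishing quadratic forms on the product of circle and sphere\<close>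

lemma has_sum_sum_finite:
  fixes f :: "'i \<Rightarrow> 'a \<Rightarrow> real"
  assumes "\<And>i. i \<in> I \<Longrightarrow> (f i has_sum s i) A"
  shows "((\<lambda>x. \<Sum>i\<in>I. f i x) has_sum (\<Sum>i\<in>I. s i)) A"
  using assms by (induction I rule: infinite_finite_induct) (auto intro: has_sum_add)

text \<open>Points forming a full grid \<open>X \<times> Z\<close> allow the summations over the
  circle and over the sphere to be carried out separately.\<close>

lemma circle_sphere_zeroD:
  fixes w :: "real ^ 2 \<Rightarrow> real ^ 'n::finite \<Rightarrow> real"
  assumes m: "m \<ge> 2" "CARD('n) = m + 1"
    and X: "finite X" "X \<subseteq> sphere 0 1" and Z: "finite Z" "Z \<subseteq> sphere 0 1"
    and J: "{l. {k. (k, l) \<in> coeff_support m f} \<in> SPD TYPE(2)} \<in> SPD TYPE('n)"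
    and zero: "(\<Sum>(x, z)\<in>X \<times> Z. \<Sum>(y, v)\<in>X \<times> Z. w x z * w y v * f (x \<bullet> y) (z \<bullet> v)) = 0"
    and "x \<in> X" "z \<in> Z"
  shows "w x z = 0"
proof -
  have "\<exists>F (Y :: (nat \<Rightarrow> real ^ 'n) \<Rightarrow> real ^ 'n \<Rightarrow> real). finite F \<and>
    (\<forall>z v. norm z = 1 \<longrightarrow> norm v = 1 \<longrightarrow> sphere_poly m l (z \<bullet> v) = (\<Sum>i\<in>F. Y i z * Y i v))" for l
    by (rule sphere_poly_inner_decomposition[OF m(2,1)])
  then obtain F and Y :: "nat \<Rightarrow> (nat \<Rightarrow> real ^ 'n) \<Rightarrow> real ^ 'n \<Rightarrow> real" where F: "\<And>l. finite (F l)"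
    and Y': "\<And>l z v. norm z = 1 \<Longrightarrow> norm v = 1 \<Longrightarrow> sphere_poly m l (z \<bullet> v) = (\<Sum>i\<in>F l. Y l i z * Y l i v)"
    by metis
  have Y: "sphere_poly m l (z \<bullet> v) = (\<Sum>i\<in>F l. Y l i z * Y l i v)" if "z \<in> Z" "v \<in> Z" for l z v
    by (rule Y') (use that Z(2) in auto)
  \<comment> \<open>\<open>V l i\<close> serves as a weight on the circle, and
    \<open>r k l i\<close> is its form for the circle polynomial of degree \<open>k\<close>;
    \<open>q k l\<close> is the form of \<open>w\<close> for one product of polynomials.\<close>
  define V where "V l i x = (\<Sum>z\<in>Z. w x z * Y l i z)" for l i x
  define q where "q k l = (\<Sum>(x, z)\<in>X \<times> Z. \<Sum>(y, v)\<in>X \<times> Z.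
      w x z * w y v * (sphere_poly 1 k (x \<bullet> y) * sphere_poly m l (z \<bullet> v)))" for k l
  define r where "r k l i = (\<Sum>x\<in>X. \<Sum>y\<in>X. V l i x * V l i y * sphere_poly 1 k (x \<bullet> y))" for k l i
  \<comment> \<open>Different \<open>x\<close> and \<open>y\<close> are needed to split
    \<open>q k l\<close> into circle forms; the case \<open>y = x\<close> later leads from
    \<open>V\<close> back to the row \<open>w x\<close>.\<close>
  have VV: "(\<Sum>z\<in>Z. \<Sum>v\<in>Z. w x z * w y v * sphere_poly m l (z \<bullet> v)) = (\<Sum>i\<in>F l. V l i x * V l i y)" for x y l
  proof -
    have "(\<Sum>i\<in>F l. V l i x * V l i y) =
        (\<Sum>i\<in>F l. \<Sum>z\<in>Z. \<Sum>v\<in>Z. w x z * w y v * (Y l i z * Y l i v))"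
      unfolding V_def sum_product by (simp only: mult_ac)
    also have "\<dots> = (\<Sum>z\<in>Z. \<Sum>v\<in>Z. \<Sum>i\<in>F l. w x z * w y v * (Y l i z * Y l i v))"
      by (simp add: sum.swap[of _ "F l"])
    also have "\<dots> = (\<Sum>z\<in>Z. \<Sum>v\<in>Z. w x z * w y v * sphere_poly m l (z \<bullet> v))"
      by (intro sum.cong refl) (simp add: Y sum_distrib_left)
    finally show ?thesis ..
  qed
  have q: "q k l = (\<Sum>i\<in>F l. r k l i)" for k l
  proof -
    have "q k l = (\<Sum>x\<in>X. \<Sum>z\<in>Z. \<Sum>y\<in>X. \<Sum>v\<in>Z. w x z * w y v * (sphere_poly 1 k (x \<bullet> y) * sphere_poly m l (z \<bullet> v)))"
      unfolding q_def sum.cartesian_product[symmetric] by (rule refl)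
    also have "\<dots> = (\<Sum>x\<in>X. \<Sum>y\<in>X. \<Sum>z\<in>Z. \<Sum>v\<in>Z. w x z * w y v * (sphere_poly 1 k (x \<bullet> y) * sphere_poly m l (z \<bullet> v)))"
      by (intro sum.cong refl sum.swap)
    also have "\<dots> = (\<Sum>x\<in>X. \<Sum>y\<in>X. (\<Sum>i\<in>F l. V l i x * V l i y) * sphere_poly 1 k (x \<bullet> y))"
      unfolding VV[symmetric] sum_distrib_right by (simp only: mult_ac)
    also have "\<dots> = (\<Sum>i\<in>F l. r k l i)"
      unfolding r_def sum_distrib_right by (simp add: sum.swap[of _ "F l"])
    finally show ?thesis .
  qed
  have r_nonneg: "r k l i \<ge> 0" for k l i
    unfolding r_def by (rule sphere_poly_1_nonneg[OF X(2)])
  then have q_nonneg: "q k l \<ge> 0" for k l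
    unfolding q by (rule sum_nonneg)
  \<comment> \<open>Any expansion witnessing \<open>(k, l) \<in> coeff_support m f\<close> will do, so uniqueness of the
    coefficients plays no role.\<close>
  have q_zero: "q k l = 0" if kl: "(k, l) \<in> coeff_support m f" for k l
  proof -
    obtain a where a: "circle_sphere_expansion m f a" "a k l > 0"
        using kl unfolding coeff_support_def by blast
    have "((\<lambda>(k, l). a k l * sphere_poly 1 k (x \<bullet> y) * sphere_poly m l (z \<bullet> v)) has_sum f (x \<bullet> y) (z \<bullet> v)) UNIV"
      if "x \<in> X" "y \<in> X" "z \<in> Z" "v \<in> Z" for x y z v
    proof -
      have "x \<bullet> y \<in> {- 1..1}" "z \<bullet> v \<in> {- 1..1}"
        using that X(2) Z(2) by (auto intro!: inner_unit_mem simp del: atLeastAtMost_iff)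
      then show ?thesis
        using a(1) unfolding circle_sphere_expansion_def by blast
    qed
    \<comment> \<open>The finite form is moved inside the unconditional double series, whose terms
      become \<open>a k l * q k l\<close>.\<close>
    then have "((\<lambda>kl. \<Sum>p\<in>X \<times> Z. \<Sum>p'\<in>X \<times> Z. w (fst p) (snd p) * w (fst p') (snd p') *
          (case kl of (k, l) \<Rightarrow> a k l * sphere_poly 1 k (fst p \<bullet> fst p') * sphere_poly m l (snd p \<bullet> snd p'))) has_sum
        (\<Sum>p\<in>X \<times> Z. \<Sum>p'\<in>X \<times> Z. w (fst p) (snd p) * w (fst p') (snd p') *
          f (fst p \<bullet> fst p') (snd p \<bullet> snd p'))) UNIV"
      by (intro has_sum_sum_finite has_sum_cmult_right) auto
    also have "(\<lambda>kl. \<Sum>p\<in>X \<times> Z. \<Sum>p'\<in>X \<times> Z. w (fst p) (snd p) * w (fst p') (snd p') *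
          (case kl of (k, l) \<Rightarrow> a k l * sphere_poly 1 k (fst p \<bullet> fst p') * sphere_poly m l (snd p \<bullet> snd p'))) =
        (\<lambda>(k, l). a k l * q k l)"
      unfolding q_def by (simp add: fun_eq_iff split_def sum_distrib_left mult_ac)
    also have "(\<Sum>p\<in>X \<times> Z. \<Sum>p'\<in>X \<times> Z. w (fst p) (snd p) * w (fst p') (snd p') *
          f (fst p \<bullet> fst p') (snd p \<bullet> snd p')) = 0"
      using zero by (simp add: split_def)
    finally have "(\<lambda>(k, l). a k l * q k l) (k, l) = 0"
      by (rule nonneg_has_sum_le_0D)
        (use a(1) q_nonneg in \<open>auto simp: circle_sphere_expansion_def\<close>)
    with a(2) show ?thesis by simp
  qed
  have "(\<Sum>z\<in>Z. \<Sum>v\<in>Z. w x z * w x v * sphere_poly (CARD('n) - 1) l (z \<bullet> v)) = 0"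
    if l: "{k. (k, l) \<in> coeff_support m f} \<in> SPD TYPE(2)" for l
  proof -
    \<comment> \<open>For every \<open>k\<close> paired with \<open>l\<close>, the nonnegative
      numbers \<open>r k l i\<close> add up to \<open>q k l = 0\<close>, so the circle form of
      \<open>V l i\<close> vanishes on an index set in SPD of the circle.\<close>
    have "V l i x = 0" if "i \<in> F l" for i
    proof (rule SPD_zeroD[OF l X])
      fix k assume "k \<in> {k. (k, l) \<in> coeff_support m f}"
      then have "q k l = 0" using q_zero by simp
      then have "r k l i = 0"
        unfolding q using sum_nonneg_eq_0_iff[OF F] r_nonneg that by blast
      then show "(\<Sum>x\<in>X. \<Sum>y\<in>X. V l i x * V l i y * sphere_poly (CARD(2) - 1) k (x \<bullet> y)) = 0"
        by (simp add: r_def)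
    qed (fact \<open>x \<in> X\<close>)
    then show ?thesis
      by (simp add: m(2) VV)
  qed
  then show ?thesis
    by (intro SPD_zeroD[OF J Z _ \<open>z \<in> Z\<close>, of "w x"]) (simp only: mem_Collect_eq)
qed

theorem theorem2p5:
  fixes m :: nat and f :: "real \<Rightarrow> real \<Rightarrow> real"
  assumes "m \<ge> 2" and "CARD('n::finite) = m + 1"
    and "continuous_on ({-1..1} \<times> {-1..1}) (\<lambda>(t, s). f t s)"
    and "pos_def_kernel (sphere (0 :: real ^ 2) 1 \<times> sphere (0 :: real ^ 'n) 1)
           (\<lambda>(x, z) (y, w). f (x \<bullet> y) (z \<bullet> w))"
    and "{l. {k. (k, l) \<in> coeff_support m f} \<in> SPD TYPE(2)} \<in> SPD TYPE('n)"
  shows "strictly_pos_def_kernel (sphere (0 :: real ^ 2) 1 \<times> sphere (0 :: real ^ 'n) 1)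
           (\<lambda>(x, z) (y, w). f (x \<bullet> y) (z \<bullet> w))"
proof (rule strictly_pos_def_kernelI[OF assms(4)])
  fix S :: "((real ^ 2) \<times> (real ^ 'n)) set" and c u
  assume S: "finite S" "S \<subseteq> sphere 0 1 \<times> sphere 0 1" and u: "u \<in> S"
    and zero: "(\<Sum>u\<in>S. \<Sum>v\<in>S. c u * c v * (case u of (x, z) \<Rightarrow> \<lambda>(y, w). f (x \<bullet> y) (z \<bullet> w)) v) = 0"
  \<comment> \<open>The finite set \<open>S\<close> is enlarged to the grid of its two projections,
    with weight 0 at the added points.\<close>
  define w where "w x z = (if (x, z) \<in> S then c (x, z) else 0)" for x z
  define X where "X = fst ` S"
  define Z where "Z = snd ` S"
  have fin: "finite X" "finite Z" and sub: "X \<subseteq> sphere 0 1" "Z \<subseteq> sphere 0 1" "S \<subseteq> X \<times> Z"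
    using S subset_fst_snd[of S] unfolding X_def Z_def by auto
  have "(\<Sum>(x, z)\<in>X \<times> Z. \<Sum>(y, v)\<in>X \<times> Z. w x z * w y v * f (x \<bullet> y) (z \<bullet> v)) =
      (\<Sum>(x, z)\<in>S. \<Sum>(y, v)\<in>X \<times> Z. w x z * w y v * f (x \<bullet> y) (z \<bullet> v))"
    by (rule sum.mono_neutral_right) (use fin sub in \<open>auto simp: w_def\<close>)
  also have "\<dots> = (\<Sum>(x, z)\<in>S. \<Sum>(y, v)\<in>S. w x z * w y v * f (x \<bullet> y) (z \<bullet> v))"
    unfolding split_def
    by (intro sum.cong refl sum.mono_neutral_right) (use fin sub in \<open>auto simp: w_def\<close>)
  also have "\<dots> = (\<Sum>u\<in>S. \<Sum>v\<in>S. c u * c v * (case u of (x, z) \<Rightarrow> \<lambda>(y, w). f (x \<bullet> y) (z \<bullet> w)) v)"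
    by (intro sum.cong refl) (auto simp: w_def intro!: sum.cong)
  finally have w: "w x z = 0" if "x \<in> X" "z \<in> Z" for x z
    using circle_sphere_zeroD[OF assms(1,2) fin(1) sub(1) fin(2) sub(2) assms(5) _ that, of w] zero
    by simp
  have "u \<in> X \<times> Z"
    using u sub(3) by blast
  then have "w (fst u) (snd u) = 0"
    by (intro w) auto
  with u show "c u = 0"
    by (simp add: w_def)
qed

end
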